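(* Let $N\ge 1$ and, for each $\alpha=1,\dots,N$, let $H_\alpha$ satisfy assumption (A1) stated in the context. Let $\Delta x,\Delta t>0$, and let $(U^{\alpha,n}_i)_{\alpha=1,\dots,N,\ i\ge 0,\ n\ge 0}$ be the numerical solution of the scheme described in the context with initial condition $U^{\alpha,0}_i=u_0^\alpha(i\Delta x)$. Let $$m^n=\inf_{\alpha=1,\dots,N,\ i\ge 0} W^{\alpha,n}_i,\qquad M^n=\sup_{\alpha=1,\dots,N,\ i\ge 0} W^{\alpha,n}_i,$$ and $\underline p_\alpha=(H_\alpha^-)^{-1}(-m^0)$, $\overline p_\alpha=(H_\alpha^+)^{-1}(-m^0)$. Assume that $m^0$ is finite and that the CFL condition $$\frac{\Delta x}{\Delta t}\ \ge\ \sup_{\alpha=1,\dots,N,\ p\in[\underline p_\alpha,\overline p_\alpha]}|H_\alpha'(p)|$$ holds. Then for every $n\ge 0$: (i) $\underline p_\alpha\le p^{\alpha,n}_{i,+}\le\overline p_\alpha$ for all $i\ge 0$ and $\alpha=1,\dots,N$; (ii) $m^0\le m^n\le m^{n+1}\le M^{n+1}\le M^n\le M^0$.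
   Context: Assumption (A1): for each $\alpha$, $H_\alpha\in C^1(\mathbb R;\mathbb R)$ is coercive, i.e. $\lim_{|p|\to+\infty}H_\alpha(p)=+\infty$, and there is $p_0^\alpha\in\mathbb R$ such that $H_\alpha$ is non-increasing on $(-\infty,p_0^\alpha]$ and non-decreasing on $[p_0^\alpha,+\infty)$; $p_0^\alpha$ is assumed to be unique (no plateau at the minimum of $H_\alpha$). Set $H_\alpha^-(p)=H_\alpha(p)$ for $p\le p_0^\alpha$ and $H_\alpha^-(p)=H_\alpha(p_0^\alpha)$ for $p\ge p_0^\alpha$; $H_\alpha^+(p)=H_\alpha(p_0^\alpha)$ for $p\le p_0^\alpha$ and $H_\alpha^+(p)=H_\alpha(p)$ for $p\ge p_0^\alpha$. Generalized inverses: $(H_\alpha^-)^{-1}(a):=\inf\{p: H_\alpha^-(p)=a\}$ and $(H_\alpha^+)^{-1}(a):=\sup\{p: H_\alpha^+(p)=a\}$, with the convention $(H_\alpha^\pm)^{-1}(+\infty)=\pm\infty$. Initial data: functions $u_0^\alpha:[0,+\infty)\to\mathbb R$, $\alpha=1,\dots,N$, with a common value $u_0^\alpha(0)=u_0^\beta(0)$ at $0$. Notation: $p^{\alpha,n}_{i,+}=\frac{U^{\alpha,n}_{i+1}-U^{\alpha,n}_i}{\Delta x}$ ($i\ge 0$), $p^{\alpha,n}_{i,-}=\frac{U^{\alpha,n}_i-U^{\alpha,n}_{i-1}}{\Delta x}$ ($i\ge 1$), $W^{\alpha,n}_i=\frac{U^{\alpha,n+1}_i-U^{\alpha,n}_i}{\Delta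 t}$. Scheme: for all $n\ge 0$, $$W^{\alpha,n}_i+\max\{H_\alpha^+(p^{\alpha,n}_{i,-}),H_\alpha^-(p^{\alpha,n}_{i,+})\}=0\quad (i\ge 1,\ \alpha=1,\dots,N),$$ and at $i=0$: $U^{\beta,n}_0=:U^n_0$ is the same for all $\beta=1,\dots,N$, and $$\frac{U^{n+1}_0-U^n_0}{\Delta t}+\max_{\beta=1,\dots,N}H_\beta^-(p^{\beta,n}_{0,+})=0.$$ Note that $(W^{\alpha,0}_i)$, hence $m^0$, $\underline p_\alpha$, $\overline p_\alpha$, depend on $\Delta x$ and the initial data but not on $\Delta t$. *)

theory Defs
  imports "HOL-Analysis.Analysis"
begin

definition is_min_point :: "(real \<Rightarrow> real) \<Rightarrow> real \<Rightarrow> bool" where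
  "is_min_point H p\<^sub>0 \<longleftrightarrow> antimono_on {..p\<^sub>0} H \<and> mono_on {p\<^sub>0..} H"

(* Uniqueness of the switching point rules out a plateau at the minimum of H. *)
definition admissible_hamiltonian :: "(real \<Rightarrow> real) \<Rightarrow> bool" where
  "admissible_hamiltonian H \<longleftrightarrow>
     H C1_differentiable_on UNIV \<and>
     filterlim H at_top at_infinity \<and>
     (\<exists>!p\<^sub>0. is_min_point H p\<^sub>0)"

definition min_point :: "(real \<Rightarrow> real) \<Rightarrow> real" where
  "min_point H = (THE p\<^sub>0. is_min_point H p\<^sub>0)"

definition H_minus :: "(real \<Rightarrow> real) \<Rightarrow> real \<Rightarrow> real" where
  "H_minus H p = (if p \<le> min_point H then H p else H (min_point H))"

definition H_plus :: "(real \<Rightarrow> real) \<Rightarrow> real \<Rightarrow> real" where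
  "H_plus H p = (if p \<le> min_point H then H (min_point H) else H p)"

(* Generalized inverses take extended real values, because the value +infinity of the
   argument is sent to -infinity and +infinity respectively, by convention. *)
definition H_minus_inv :: "(real \<Rightarrow> real) \<Rightarrow> ereal \<Rightarrow> ereal" where
  "H_minus_inv H a = (if a = \<infinity> then -\<infinity> else Inf (ereal ` {p. ereal (H_minus H p) = a}))"

definition H_plus_inv :: "(real \<Rightarrow> real) \<Rightarrow> ereal \<Rightarrow> ereal" where
  "H_plus_inv H a = (if a = \<infinity> then \<infinity> else Sup (ereal ` {p. ereal (H_plus H p) = a}))"

(* A discrete function is written U \<alpha> n i: branch \<alpha>, time step n, node i. *)
type_synonym grid_fun = "nat \<Rightarrow> nat \<Rightarrow> nat \<Rightarrow> real"

definition grad_plus :: "real \<Rightarrow> grid_fun \<Rightarrow> grid_fun" where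
  "grad_plus \<Delta>x U \<alpha> n i = (U \<alpha> n (i + 1) - U \<alpha> n i) / \<Delta>x"

(* Only meaningful for i \<ge> 1, because of the truncated subtraction. *)
definition grad_minus :: "real \<Rightarrow> grid_fun \<Rightarrow> grid_fun" where
  "grad_minus \<Delta>x U \<alpha> n i = (U \<alpha> n i - U \<alpha> n (i - 1)) / \<Delta>x"

definition time_diff :: "real \<Rightarrow> grid_fun \<Rightarrow> grid_fun" where
  "time_diff \<Delta>t U \<alpha> n i = (U \<alpha> (n + 1) i - U \<alpha> n i) / \<Delta>t"

definition numerical_solution ::
  "nat \<Rightarrow> (nat \<Rightarrow> real \<Rightarrow> real) \<Rightarrow> real \<Rightarrow> real \<Rightarrow> (nat \<Rightarrow> real \<Rightarrow> real) \<Rightarrow> grid_fun \<Rightarrow> bool" where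
  "numerical_solution N H \<Delta>x \<Delta>t u\<^sub>0 U \<longleftrightarrow>
     (\<forall>\<alpha>\<in>{1..N}. \<forall>i. U \<alpha> 0 i = u\<^sub>0 \<alpha> (real i * \<Delta>x)) \<and>
     (\<forall>n. \<forall>\<alpha>\<in>{1..N}. \<forall>i\<ge>1.
        time_diff \<Delta>t U \<alpha> n i
          + max (H_plus (H \<alpha>) (grad_minus \<Delta>x U \<alpha> n i)) (H_minus (H \<alpha>) (grad_plus \<Delta>x U \<alpha> n i)) = 0) \<and>
     (\<forall>n. \<forall>\<alpha>\<in>{1..N}. \<forall>\<beta>\<in>{1..N}. U \<alpha> n 0 = U \<beta> n 0) \<and>
     (\<forall>n. \<forall>\<alpha>\<in>{1..N}.
        time_diff \<Delta>t U \<alpha> n 0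
          + Max ((\<lambda>\<beta>. H_minus (H \<beta>) (grad_plus \<Delta>x U \<beta> n 0)) ` {1..N}) = 0)"

definition m_inf :: "nat \<Rightarrow> real \<Rightarrow> grid_fun \<Rightarrow> nat \<Rightarrow> ereal" where
  "m_inf N \<Delta>t U n = (INF (\<alpha>, i)\<in>{1..N} \<times> UNIV. ereal (time_diff \<Delta>t U \<alpha> n i))"

definition M_sup :: "nat \<Rightarrow> real \<Rightarrow> grid_fun \<Rightarrow> nat \<Rightarrow> ereal" where
  "M_sup N \<Delta>t U n = (SUP (\<alpha>, i)\<in>{1..N} \<times> UNIV. ereal (time_diff \<Delta>t U \<alpha> n i))"

definition p_lower :: "nat \<Rightarrow> (nat \<Rightarrow> real \<Rightarrow> real) \<Rightarrow> real \<Rightarrow> grid_fun \<Rightarrow> nat \<Rightarrow> ereal" where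
  "p_lower N H \<Delta>t U \<alpha> = H_minus_inv (H \<alpha>) (- m_inf N \<Delta>t U 0)"

definition p_upper :: "nat \<Rightarrow> (nat \<Rightarrow> real \<Rightarrow> real) \<Rightarrow> real \<Rightarrow> grid_fun \<Rightarrow> nat \<Rightarrow> ereal" where
  "p_upper N H \<Delta>t U \<alpha> = H_plus_inv (H \<alpha>) (- m_inf N \<Delta>t U 0)"

definition CFL :: "nat \<Rightarrow> (nat \<Rightarrow> real \<Rightarrow> real) \<Rightarrow> real \<Rightarrow> real \<Rightarrow> grid_fun \<Rightarrow> bool" where
  "CFL N H \<Delta>x \<Delta>t U \<longleftrightarrow>
     ereal (\<Delta>x / \<Delta>t) \<ge>
       (SUP (\<alpha>, p)\<in>(SIGMA \<alpha>:{1..N}. {p. p_lower N H \<Delta>t U \<alpha> \<le> ereal p \<and> ereal p \<le> p_upper N H \<Delta>t U \<alpha>}).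
          ereal \<bar>deriv (H \<alpha>) p\<bar>)"

end

(* For constants c the shifted function U + c dt moves under the scheme exactly like U, so a monotone
   scheme propagates one-sided bounds on W = (U^(n+1) - U^n)/dt in time. Under the CFL condition the
   scheme is monotone only for gradients p with H(p) <= a := -m^0. The nonlinearities H^+ and H^- are
   therefore continued outside {H <= a} by affine functions of slope dx/dt; the modified scheme is
   monotone everywhere. It preserves W >= m^0, which bounds the modified fluxes by a, and below the
   level a both pairs of nonlinearities coincide, so U solves the modified scheme at all times. *)

theory Submission
  imports Defs
begin

section \<open>Monotone Lipschitz extension beyond a level\<close>

text \<open>Expresses monotonicity (\<open>e = 0\<close>) and the Lipschitz bound in a single inequality.\<close>

definition mono_lipschitz :: "real \<Rightarrow> (real \<Rightarrow> real) \<Rightarrow> bool" where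
  "mono_lipschitz L f \<longleftrightarrow> (\<forall>x y e. 0 \<le> e \<longrightarrow> y \<le> x + e \<longrightarrow> f y \<le> f x + L * e)"

lemma attains_level_above:
  fixes f :: "real \<Rightarrow> real"
  assumes "continuous_on UNIV f" "filterlim f at_top at_top" "f p \<le> a"
  obtains q where "p \<le> q" "f q = a"
proof -
  have "eventually (\<lambda>x. a \<le> f x \<and> p \<le> x) at_top"
    using assms(2) eventually_ge_at_top by (auto simp: filterlim_at_top intro: eventually_conj)
  then obtain b where "a \<le> f b" "p \<le> b"
    by (auto simp: eventually_at_top_linorder)
  moreover have "continuous_on {p..b} f"
    using assms(1) by (rule continuous_on_subset) simp
  ultimately show ?thesis
    using IVT'[of f p a b] assms(3) that by auto
qed

text \<open>The extension follows \<open>f\<close> up to the last point \<open>q\<close> of the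
  sublevel set and continues with slope \<open>L\<close>. As \<open>f q = a\<close> and
  \<open>0 < L\<close>, both \<open>f\<close> and \<open>g\<close> exceed \<open>a\<close> beyond
  \<open>q\<close>, so a bound by \<open>a\<close> on either one forces agreement. The disjunction
  lets bounds be transferred in both directions.\<close>

lemma mono_lipschitz_extension:
  fixes f :: "real \<Rightarrow> real"
  assumes cont: "continuous_on UNIV f" and mono: "mono f" and top: "filterlim f at_top at_top"
    and p: "f p \<le> a" and "0 < L"
    and lip: "\<And>x y. x \<le> y \<Longrightarrow> f y \<le> a \<Longrightarrow> f y \<le> f x + L * (y - x)"
  obtains g where "mono_lipschitz L g" "\<And>x. f x \<le> a \<or> g x \<le> a \<Longrightarrow> g x = f x"
proof -
  define q where "q = Sup {x. f x \<le> a}"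
  obtain b where b: "\<And>x. b \<le> x \<Longrightarrow> a < f x"
    using filterlim_at_top_dense[THEN iffD1, OF top, rule_format, of a]
    by (auto simp: eventually_at_top_linorder)
  have bdd: "bdd_above {x. f x \<le> a}"
  proof (rule bdd_aboveI)
    fix x
    assume "x \<in> {x. f x \<le> a}"
    then show "x \<le> b"
      using b[of x] by (cases "b \<le> x") auto
  qed
  have "closed {x. f x \<le> a}"
    using cont by (intro closed_Collect_le) auto
  then have "f q \<le> a"
    using closed_contains_Sup[of "{x. f x \<le> a}"] bdd p by (auto simp: q_def)
  have le_q: "f x \<le> a \<longleftrightarrow> x \<le> q" for x
    using monoD[OF mono, of x q] \<open>f q \<le> a\<close> cSup_upper[OF _ bdd, of x] by (auto simp: q_def)
  \<comment> \<open>The level \<open>a\<close> is attained at some point to the right of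
    \<open>q\<close>; by \<open>le_q\<close> that point cannot lie beyond \<open>q\<close>.\<close>
  have fq: "f q = a"
    using attains_level_above[OF cont top \<open>f q \<le> a\<close>] le_q
    by (metis antisym order_refl)
  define g where "g x = f (min x q) + L * max 0 (x - q)" for x
  have "mono_lipschitz L g"
    unfolding mono_lipschitz_def
  proof (intro allI impI)
    fix x y e :: real
    assume e: "0 \<le> e" "y \<le> x + e"
    show "g y \<le> g x + L * e"
    proof (cases "y \<le> x")
      case True
      have "f (min y q) \<le> f (min x q)"
        using True by (intro monoD[OF mono]) auto
      moreover have "L * max 0 (y - q) \<le> L * max 0 (x - q)" "0 \<le> L * e"
        using True e \<open>0 < L\<close> by auto
      ultimately show ?thesis by (simp add: g_def)
    next
      case False
      have "f (min y q) \<le> f (min x q) + L * (min y q - min x q)"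
        using False by (intro lip) (auto simp: le_q)
      \<comment> \<open>Since \<open>min t q + max 0 (t - q) = t\<close>, the bracket is just
        \<open>y - x\<close>: the part below \<open>q\<close> is paid for by \<open>lip\<close>, the
        part above by the affine slope.\<close>
      moreover have "L * (min y q - min x q + max 0 (y - q) - max 0 (x - q)) \<le> L * e"
        using False e \<open>0 < L\<close> by (intro mult_left_mono) auto
      ultimately show ?thesis by (simp add: g_def algebra_simps)
    qed
  qed
  moreover have "g x = f x" if "f x \<le> a \<or> g x \<le> a" for x
  proof -
    have "x \<le> q"
    proof (rule ccontr)
      assume "\<not> x \<le> q"
      then have "g x > a" "\<not> f x \<le> a"
        using \<open>0 < L\<close> le_q by (auto simp: g_def fq)
      then show False using that by simp
    qed
    then show ?thesis by (simp add: g_def)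
  qed
  ultimately show ?thesis using that by blast
qed

section \<open>Hamiltonians\<close>

lemma is_min_point_min_point:
  assumes "admissible_hamiltonian H"
  shows "is_min_point H (min_point H)"
  using assms unfolding admissible_hamiltonian_def min_point_def by (blast intro: theI')

text \<open>Writing the branches as \<open>H\<close> after a truncation of the argument gives their
  continuity by composition and lets increment bounds for \<open>H\<close> carry over, truncation
  being 1-Lipschitz.\<close>

lemma H_minus_eq: "H_minus H p = H (min p (min_point H))"
  by (simp add: H_minus_def min_def)

lemma H_plus_eq: "H_plus H p = H (max p (min_point H))"
  by (simp add: H_plus_def max_def)

text \<open>At each point one of the two branches equals \<open>H p\<close> and the other equals the
  minimum of \<open>H\<close>.\<close>

lemma hamiltonian_le_iff:
  assumes "admissible_hamiltonian H"
  shows "H p \<le> a \<longleftrightarrow> H_minus H p \<le> a \<and> H_plus H p \<le> a"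
proof -
  have "H (min_point H) \<le> H p"
    using is_min_point_min_point[OF assms]
    by (cases "p \<le> min_point H") (auto simp: is_min_point_def monotone_on_def)
  then show ?thesis
    by (auto simp: H_minus_def H_plus_def)
qed

lemma hamiltonian_has_derivative:
  assumes "admissible_hamiltonian H"
  shows "(H has_real_derivative deriv H x) (at x)"
  using assms unfolding admissible_hamiltonian_def C1_differentiable_on_def
  by (metis DERIV_imp_deriv UNIV_I has_real_derivative_iff_has_vector_derivative)

lemma continuous_on_hamiltonian:
  assumes "admissible_hamiltonian H"
  shows "continuous_on A H"
  using hamiltonian_has_derivative[OF assms] DERIV_isCont
  by (metis continuous_at_imp_continuous_on)

lemma hamiltonian_at_top:
  assumes "admissible_hamiltonian H"
  shows "filterlim H at_top at_top" "filterlim (\<lambda>x. H (- x)) at_top at_top"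
proof -
  have "filterlim H at_top at_infinity"
    using assms by (simp add: admissible_hamiltonian_def)
  then show "filterlim H at_top at_top" "filterlim (\<lambda>x. H (- x)) at_top at_top"
    using filterlim_mono[OF _ order_refl, of H at_top at_infinity]
    by (auto simp: at_top_le_at_infinity at_bot_le_at_infinity filterlim_at_bot_mirror[symmetric])
qed

lemma H_plus_regular:
  assumes "admissible_hamiltonian H"
  shows "continuous_on UNIV (H_plus H)" "mono (H_plus H)" "filterlim (H_plus H) at_top at_top"
proof -
  show "continuous_on UNIV (H_plus H)"
    using continuous_on_compose2[OF continuous_on_hamiltonian[OF assms, of UNIV], of UNIV
        "\<lambda>p. max p (min_point H)"]
    by (simp add: H_plus_eq[abs_def] continuous_on_max)
  show "mono (H_plus H)"
    using is_min_point_min_point[OF assms]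
    by (auto simp: is_min_point_def H_plus_eq monotone_on_def)
  have "eventually (\<lambda>x. H x = H_plus H x) at_top"
    using eventually_ge_at_top[of "min_point H"] by eventually_elim (simp add: H_plus_eq max_def)
  then show "filterlim (H_plus H) at_top at_top"
    using hamiltonian_at_top(1)[OF assms] by (rule filterlim_mono_eventually[rotated 3]) auto
qed

text \<open>After reflection the decreasing branch meets the hypotheses of the extension lemma,
  which is stated for nondecreasing functions only.\<close>

lemma H_minus_mirror_regular:
  assumes "admissible_hamiltonian H"
  shows "continuous_on UNIV (\<lambda>x. H_minus H (- x))" "mono (\<lambda>x. H_minus H (- x))"
    "filterlim (\<lambda>x. H_minus H (- x)) at_top at_top"
proof -
  show "continuous_on UNIV (\<lambda>x. H_minus H (- x))"
    using continuous_on_compose2[OF continuous_on_hamiltonian[OF assms, of UNIV], of UNIV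
        "\<lambda>x. min (- x) (min_point H)"]
    by (simp add: H_minus_eq continuous_on_min continuous_on_minus)
  show "mono (\<lambda>x. H_minus H (- x))"
    using is_min_point_min_point[OF assms]
    by (auto simp: is_min_point_def H_minus_eq monotone_on_def)
  have "eventually (\<lambda>x. H (- x) = H_minus H (- x)) at_top"
    using eventually_ge_at_top[of "- min_point H"]
    by eventually_elim (simp add: H_minus_eq min_def)
  then show "filterlim (\<lambda>x. H_minus H (- x)) at_top at_top"
    using hamiltonian_at_top(2)[OF assms] by (rule filterlim_mono_eventually[rotated 3]) auto
qed

text \<open>Coercivity and the intermediate value theorem give a point left of \<open>p\<close>
  where \<open>H_minus\<close> equals \<open>a\<close> and one right of \<open>p\<close> where
  \<open>H_plus\<close> does; the infimum and supremum lie at least as far out. This turns the CFL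
  condition into a derivative bound on {H <= a}, and sublevel bounds on gradients into claim
  (i).\<close>

lemma sublevel_between_inverses:
  assumes "admissible_hamiltonian H" and "H p \<le> a"
  shows "H_minus_inv H (ereal a) \<le> ereal p" "ereal p \<le> H_plus_inv H (ereal a)"
proof -
  have "H_minus H p \<le> a" "H_plus H p \<le> a"
    using assms hamiltonian_le_iff by auto
  obtain q where "- p \<le> q" "H_minus H (- q) = a"
    using attains_level_above[OF H_minus_mirror_regular(1,3)[OF assms(1)], of "- p" a]
      \<open>H_minus H p \<le> a\<close> by auto
  then show "H_minus_inv H (ereal a) \<le> ereal p"
    unfolding H_minus_inv_def by (auto intro!: INF_lower2[of "- q"])
  obtain r where "p \<le> r" "H_plus H r = a"
    using attains_level_above[OF H_plus_regular(1,3)[OF assms(1)] \<open>H_plus H p \<le> a\<close>] by auto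
  then show "ereal p \<le> H_plus_inv H (ereal a)"
    unfolding H_plus_inv_def by (auto intro!: SUP_upper2[of r])
qed

text \<open>\<open>H\<close> first decreases and then increases, so its value between
  \<open>x\<close> and \<open>y\<close> never exceeds the larger endpoint value. The mean value
  point thus stays in the sublevel set, where the derivative is controlled.\<close>

lemma hamiltonian_increment_bound:
  assumes H: "admissible_hamiltonian H"
    and deriv_le: "\<And>p. H p \<le> a \<Longrightarrow> \<bar>deriv H p\<bar> \<le> L"
    and "x \<le> y" and "H x \<le> a" "H y \<le> a"
  shows "\<bar>H y - H x\<bar> \<le> L * (y - x)"
proof (cases "x = y")
  case False
  with \<open>x \<le> y\<close> obtain z where z: "x < z" "z < y" "H y - H x = (y - x) * deriv H z"
    using MVT2[of x y H "deriv H"] hamiltonian_has_derivative[OF H] by auto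
  have "H z \<le> max (H x) (H y)"
    using is_min_point_min_point[OF H] z
    by (cases "z \<le> min_point H") (auto simp: is_min_point_def monotone_on_def le_max_iff_disj)
  then have "\<bar>deriv H z\<bar> \<le> L"
    using assms(4,5) by (intro deriv_le) auto
  then have "\<bar>H y - H x\<bar> \<le> (y - x) * L"
    using z by (simp add: abs_mult mult_left_mono)
  then show ?thesis by (simp add: mult.commute)
qed simp

text \<open>The increment bound is applied to the truncated arguments, whose distance is at most
  \<open>y - x\<close>. The point \<open>p\<close> ensures that the sublevel set is
  nonempty.\<close>

lemma H_plus_extension:
  assumes H: "admissible_hamiltonian H" and "0 < L" and "H p \<le> a"
    and deriv_le: "\<And>p. H p \<le> a \<Longrightarrow> \<bar>deriv H p\<bar> \<le> L"
  shows "\<exists>g. mono_lipschitz L g \<and> (\<forall>x. H_plus H x \<le> a \<or> g x \<le> a \<longrightarrow> g x = H_plus H x)"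
proof -
  have "H_plus H y \<le> H_plus H x + L * (y - x)" if "x \<le> y" "H_plus H y \<le> a" for x y
  proof -
    have "H_plus H x \<le> a"
      using monoD[OF H_plus_regular(2)[OF H] \<open>x \<le> y\<close>] that by simp
    then have "\<bar>H_plus H y - H_plus H x\<bar>
        \<le> L * (max y (min_point H) - max x (min_point H))"
      using that unfolding H_plus_eq
      by (intro hamiltonian_increment_bound[OF H deriv_le]) auto
    also have "\<dots> \<le> L * (y - x)"
      using \<open>0 < L\<close> \<open>x \<le> y\<close> by (intro mult_left_mono) auto
    finally show ?thesis by simp
  qed
  moreover have "H_plus H p \<le> a"
    using assms hamiltonian_le_iff by auto
  ultimately show ?thesis
    using mono_lipschitz_extension[OF H_plus_regular[OF H] _ \<open>0 < L\<close>] by metis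
qed

lemma H_minus_extension:
  assumes H: "admissible_hamiltonian H" and "0 < L" and "H p \<le> a"
    and deriv_le: "\<And>p. H p \<le> a \<Longrightarrow> \<bar>deriv H p\<bar> \<le> L"
  shows "\<exists>g. mono_lipschitz L (\<lambda>x. g (- x)) \<and>
    (\<forall>x. H_minus H x \<le> a \<or> g x \<le> a \<longrightarrow> g x = H_minus H x)"
proof -
  have "H_minus H (- y) \<le> H_minus H (- x) + L * (y - x)"
    if "x \<le> y" "H_minus H (- y) \<le> a" for x y
  proof -
    have "H_minus H (- x) \<le> a"
      using monoD[OF H_minus_mirror_regular(2)[OF H] \<open>x \<le> y\<close>] that by simp
    then have "\<bar>H_minus H (- x) - H_minus H (- y)\<bar>
        \<le> L * (min (- x) (min_point H) - min (- y) (min_point H))"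
      using that unfolding H_minus_eq
      by (intro hamiltonian_increment_bound[OF H deriv_le]) auto
    also have "\<dots> \<le> L * (y - x)"
      using \<open>0 < L\<close> \<open>x \<le> y\<close> by (intro mult_left_mono) auto
    finally show ?thesis by simp
  qed
  moreover have "H_minus H (- (- p)) \<le> a"
    using assms hamiltonian_le_iff by auto
  ultimately obtain g where g: "mono_lipschitz L g"
      and g_eq: "\<And>x. H_minus H (- x) \<le> a \<or> g x \<le> a \<Longrightarrow> g x = H_minus H (- x)"
    using mono_lipschitz_extension[OF H_minus_mirror_regular[OF H], of "- p" a L] \<open>0 < L\<close>
    by blast
  have "g (- x) = H_minus H x" if "H_minus H x \<le> a \<or> g (- x) \<le> a" for x
    using g_eq[of "- x"] that by simp
  with g show ?thesis
    by (intro exI[of _ "\<lambda>x. g (- x)"]) simp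
qed

section \<open>Monotonicity of the scheme\<close>

text \<open>\<open>u\<close> is a single time slice. The nonlinearities \<open>P\<close>,
  \<open>Q\<close> are parameters so that the original flux and its modification share one formula.
  At node 0 the value is the same for every \<alpha>.\<close>

definition junction_flux ::
  "nat \<Rightarrow> real \<Rightarrow> (nat \<Rightarrow> real \<Rightarrow> real) \<Rightarrow> (nat \<Rightarrow> real \<Rightarrow> real) \<Rightarrow>
    (nat \<Rightarrow> nat \<Rightarrow> real) \<Rightarrow> nat \<Rightarrow> nat \<Rightarrow> real" where
  "junction_flux N h P Q u \<alpha> i =
     (case i of
        0 \<Rightarrow> Max ((\<lambda>\<beta>. Q \<beta> ((u \<beta> 1 - u \<beta> 0) / h)) ` {1..N})
      | Suc j \<Rightarrow> max (P \<alpha> ((u \<alpha> i - u \<alpha> j) / h)) (Q \<alpha> ((u \<alpha> (Suc i) - u \<alpha> i) / h)))"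

lemma junction_flux_le_iff:
  assumes "\<alpha> \<in> {1..N}"
  shows "junction_flux N h P Q u \<alpha> i \<le> c \<longleftrightarrow>
    (case i of
       0 \<Rightarrow> \<forall>\<beta>\<in>{1..N}. Q \<beta> ((u \<beta> 1 - u \<beta> 0) / h) \<le> c
     | Suc j \<Rightarrow> P \<alpha> ((u \<alpha> i - u \<alpha> j) / h) \<le> c \<and> Q \<alpha> ((u \<alpha> (Suc i) - u \<alpha> i) / h) \<le> c)"
proof (cases i)
  case 0
  have "(\<lambda>\<beta>. Q \<beta> ((u \<beta> 1 - u \<beta> 0) / h)) ` {1..N} \<noteq> {}"
    using assms by auto
  then show ?thesis
    unfolding 0 junction_flux_def nat.case by (subst Max_le_iff) auto
qed (simp add: junction_flux_def)

text \<open>If a maximum is at most \<open>a\<close>, so is each of its arguments, and each may be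
  replaced separately.\<close>

lemma junction_flux_eq_below:
  assumes "\<alpha> \<in> {1..N}" and "junction_flux N h P Q u \<alpha> i \<le> a"
    and "\<And>\<beta> p. \<beta> \<in> {1..N} \<Longrightarrow> P \<beta> p \<le> a \<Longrightarrow> P' \<beta> p = P \<beta> p"
    and "\<And>\<beta> p. \<beta> \<in> {1..N} \<Longrightarrow> Q \<beta> p \<le> a \<Longrightarrow> Q' \<beta> p = Q \<beta> p"
  shows "junction_flux N h P' Q' u \<alpha> i = junction_flux N h P Q u \<alpha> i"
proof (cases i)
  case 0
  have "Q' \<beta> ((u \<beta> 1 - u \<beta> 0) / h) = Q \<beta> ((u \<beta> 1 - u \<beta> 0) / h)" if "\<beta> \<in> {1..N}" for \<beta>
    using assms that unfolding junction_flux_le_iff[OF assms(1)] 0 by auto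
  then show ?thesis
    unfolding 0 junction_flux_def nat.case by (intro arg_cong[of _ _ Max] image_cong) auto
next
  case (Suc j)
  then show ?thesis
    using assms(2) assms(3,4)[OF assms(1)] unfolding junction_flux_le_iff[OF assms(1)]
    by (simp add: junction_flux_def)
qed

text \<open>Monotonicity of the one-step map \<open>u - k * flux\<close>, with a constant shift
  \<open>c\<close> that leaves gradients unchanged. Raising a node value by \<open>d\<close> changes
  the gradients there by at most \<open>d / h\<close>, hence the flux by at most
  \<open>d / k\<close>; multiplied by \<open>k\<close>, this is absorbed by the increase of the node
  value itself.\<close>

lemma junction_flux_comparison:
  assumes "0 < h" "0 < k" and \<alpha>: "\<alpha> \<in> {1..N}"
    and P: "\<And>\<beta>. \<beta> \<in> {1..N} \<Longrightarrow> mono_lipschitz (h / k) (P \<beta>)"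
    and Q: "\<And>\<beta>. \<beta> \<in> {1..N} \<Longrightarrow> mono_lipschitz (h / k) (\<lambda>x. Q \<beta> (- x))"
    and le: "\<And>\<beta> j. \<beta> \<in> {1..N} \<Longrightarrow> v \<beta> j + c \<le> u \<beta> j"
    and u0: "\<And>\<beta>. \<beta> \<in> {1..N} \<Longrightarrow> u \<beta> 0 = u \<alpha> 0"
    and v0: "\<And>\<beta>. \<beta> \<in> {1..N} \<Longrightarrow> v \<beta> 0 = v \<alpha> 0"
  shows "v \<alpha> i + c - k * junction_flux N h P Q v \<alpha> i
    \<le> u \<alpha> i - k * junction_flux N h P Q u \<alpha> i"
proof -
  define d where "d \<beta> j = u \<beta> j - v \<beta> j - c" for \<beta> j
  have d: "0 \<le> d \<beta> j" if "\<beta> \<in> {1..N}" for \<beta> j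
    using le[OF that, of j] by (simp add: d_def)
  have scale: "h / k * (t / h) = t / k" for t
    using \<open>0 < h\<close> by simp
  \<comment> \<open>Only the excess at the node carrying the flux counts: the nonnegative excess at
    the neighbour \<open>j\<close> lowers the backward gradient. In \<open>Qstep\<close> the
    neighbour is \<open>Suc j\<close>, and its excess raises the forward gradient, in which
    \<open>Q\<close> is decreasing.\<close>
  have Pstep: "P \<beta> ((u \<beta> (Suc j) - u \<beta> j) / h)
      \<le> P \<beta> ((v \<beta> (Suc j) - v \<beta> j) / h) + d \<beta> (Suc j) / k" if "\<beta> \<in> {1..N}" for \<beta> j
  proof -
    have "(u \<beta> (Suc j) - u \<beta> j) / h \<le> (v \<beta> (Suc j) - v \<beta> j) / h + d \<beta> (Suc j) / h"
      using d[OF that, of j] \<open>0 < h\<close>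
      unfolding add_divide_distrib[symmetric] by (intro divide_right_mono) (auto simp: d_def)
    moreover have "0 \<le> d \<beta> (Suc j) / h"
      using d[OF that] \<open>0 < h\<close> by simp
    ultimately show ?thesis
      using P[OF that] unfolding mono_lipschitz_def by (metis scale)
  qed
  have Qstep: "Q \<beta> ((u \<beta> (Suc j) - u \<beta> j) / h)
      \<le> Q \<beta> ((v \<beta> (Suc j) - v \<beta> j) / h) + d \<beta> j / k" if "\<beta> \<in> {1..N}" for \<beta> j
  proof -
    have "- ((u \<beta> (Suc j) - u \<beta> j) / h) \<le> - ((v \<beta> (Suc j) - v \<beta> j) / h) + d \<beta> j / h"
      using d[OF that, of "Suc j"] \<open>0 < h\<close>
      unfolding add_divide_distrib[symmetric] minus_divide_left
      by (intro divide_right_mono) (auto simp: d_def)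
    moreover have "0 \<le> d \<beta> j / h"
      using d[OF that] \<open>0 < h\<close> by simp
    ultimately show ?thesis
      using Q[OF that] unfolding mono_lipschitz_def by (metis scale minus_minus)
  qed
  have d0: "d \<beta> 0 = d \<alpha> 0" if "\<beta> \<in> {1..N}" for \<beta>
    using u0[OF that] v0[OF that] by (simp add: d_def)
  \<comment> \<open>Obtained from \<open>junction_flux_le_iff\<close> with \<open>c\<close> taken to
    be the flux itself.\<close>
  have pieces: "case i of
       0 \<Rightarrow> \<forall>\<beta>\<in>{1..N}. Q \<beta> ((v \<beta> 1 - v \<beta> 0) / h) \<le> junction_flux N h P Q v \<alpha> i
     | Suc j \<Rightarrow> P \<alpha> ((v \<alpha> i - v \<alpha> j) / h) \<le> junction_flux N h P Q v \<alpha> i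
         \<and> Q \<alpha> ((v \<alpha> (Suc i) - v \<alpha> i) / h) \<le> junction_flux N h P Q v \<alpha> i"
    using junction_flux_le_iff[OF \<alpha>] by blast
  have "junction_flux N h P Q u \<alpha> i \<le> junction_flux N h P Q v \<alpha> i + d \<alpha> i / k"
  proof (cases i)
    case 0
    have "Q \<beta> ((u \<beta> 1 - u \<beta> 0) / h) \<le> junction_flux N h P Q v \<alpha> 0 + d \<alpha> 0 / k"
      if "\<beta> \<in> {1..N}" for \<beta>
      using Qstep[OF that, of 0] bspec[OF pieces[unfolded 0 nat.case] that] d0[OF that]
      by (simp add: 0)
    then show ?thesis
      unfolding junction_flux_le_iff[OF \<alpha>] by (simp add: 0)
  next
    case (Suc j)
    then show ?thesis
      using Pstep[OF \<alpha>, of j] Qstep[OF \<alpha>, of i] pieces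
      unfolding junction_flux_le_iff[OF \<alpha>] by auto
  qed
  then have "k * junction_flux N h P Q u \<alpha> i \<le> k * junction_flux N h P Q v \<alpha> i + d \<alpha> i"
    using \<open>0 < k\<close> by (simp add: field_simps)
  then show ?thesis by (simp add: d_def)
qed

section \<open>Invariance of the gradient bounds and monotone evolution of the extrema of W\<close>

theorem theorem1p3:
  fixes N :: nat
    and H :: "nat \<Rightarrow> real \<Rightarrow> real"
    and \<Delta>x \<Delta>t :: real
    and u\<^sub>0 :: "nat \<Rightarrow> real \<Rightarrow> real"
    and U :: grid_fun
  assumes "N \<ge> 1"
    and "\<And>\<alpha>. \<alpha> \<in> {1..N} \<Longrightarrow> admissible_hamiltonian (H \<alpha>)"
    and "\<Delta>x > 0" and "\<Delta>t > 0"
    and "\<And>\<alpha> \<beta>. \<alpha> \<in> {1..N} \<Longrightarrow> \<beta> \<in> {1..N} \<Longrightarrow> u\<^sub>0 \<alpha> 0 = u\<^sub>0 \<beta> 0"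
    and "numerical_solution N H \<Delta>x \<Delta>t u\<^sub>0 U"
    and "\<bar>m_inf N \<Delta>t U 0\<bar> \<noteq> \<infinity>"
    and "CFL N H \<Delta>x \<Delta>t U"
  shows "\<forall>n.
    (\<forall>i. \<forall>\<alpha>\<in>{1..N}. p_lower N H \<Delta>t U \<alpha> \<le> ereal (grad_plus \<Delta>x U \<alpha> n i)
                   \<and> ereal (grad_plus \<Delta>x U \<alpha> n i) \<le> p_upper N H \<Delta>t U \<alpha>) \<and>
    (m_inf N \<Delta>t U 0 \<le> m_inf N \<Delta>t U n \<and>
     m_inf N \<Delta>t U n \<le> m_inf N \<Delta>t U (n + 1) \<and>
     m_inf N \<Delta>t U (n + 1) \<le> M_sup N \<Delta>t U (n + 1) \<and>
     M_sup N \<Delta>t U (n + 1) \<le> M_sup N \<Delta>t U n \<and>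
     M_sup N \<Delta>t U n \<le> M_sup N \<Delta>t U 0)"
proof -
  note H = assms(2) and \<Delta>x = \<open>\<Delta>x > 0\<close> and \<Delta>t = \<open>\<Delta>t > 0\<close> and sol = assms(6)
  let ?W = "time_diff \<Delta>t U"
  let ?F = "\<lambda>n. junction_flux N \<Delta>x (\<lambda>\<beta>. H_plus (H \<beta>)) (\<lambda>\<beta>. H_minus (H \<beta>)) (\<lambda>\<beta>. U \<beta> n)"
  obtain m where m: "m_inf N \<Delta>t U 0 = ereal m"
    using assms(7) by auto
  \<comment> \<open>As W is minus the flux, W >= m^0 means precisely that the flux is at most
    \<open>a\<close>.\<close>
  define a where "a = - m"
  have neg_m: "- m_inf N \<Delta>t U 0 = ereal a"
    by (simp add: m a_def)
  have junction: "U \<beta> n 0 = U \<alpha> n 0" if "\<alpha> \<in> {1..N}" "\<beta> \<in> {1..N}" for \<alpha> \<beta> n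
    using sol that unfolding numerical_solution_def by blast
  have W_flux: "?W \<alpha> n i = - ?F n \<alpha> i" if "\<alpha> \<in> {1..N}" for \<alpha> n i
  proof (cases i)
    case 0
    have "?W \<alpha> n 0 + Max ((\<lambda>\<beta>. H_minus (H \<beta>) (grad_plus \<Delta>x U \<beta> n 0)) ` {1..N}) = 0"
      using sol that unfolding numerical_solution_def by blast
    then show ?thesis
      by (simp add: 0 junction_flux_def grad_plus_def)
  next
    case (Suc j)
    have "?W \<alpha> n i + max (H_plus (H \<alpha>) (grad_minus \<Delta>x U \<alpha> n i))
        (H_minus (H \<alpha>) (grad_plus \<Delta>x U \<alpha> n i)) = 0"
      using sol that Suc unfolding numerical_solution_def by simp
    then show ?thesis
      by (simp add: Suc junction_flux_def grad_plus_def grad_minus_def)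
  qed
  have step: "U \<alpha> (Suc n) i = U \<alpha> n i + \<Delta>t * ?W \<alpha> n i" for \<alpha> n i
    using \<Delta>t by (simp add: time_diff_def)
  \<comment> \<open>The forward gradient at \<open>i\<close> is the backward gradient at
    \<open>Suc i\<close>: the flux at \<open>Suc i\<close> controls \<open>H_plus\<close>, the flux
    at \<open>i\<close> controls \<open>H_minus\<close>.\<close>
  have sublevel: "H \<alpha> (grad_plus \<Delta>x U \<alpha> n i) \<le> a"
    if "\<alpha> \<in> {1..N}" and le: "\<And>i. ?F n \<alpha> i \<le> a" for \<alpha> n i
  proof -
    have "H_plus (H \<alpha>) (grad_plus \<Delta>x U \<alpha> n i) \<le> a"
      using le[of "Suc i"] that(1)
      unfolding junction_flux_le_iff[OF that(1)] by (simp add: grad_plus_def)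
    moreover have "H_minus (H \<alpha>) (grad_plus \<Delta>x U \<alpha> n i) \<le> a"
      using le[of i] that(1)
      unfolding junction_flux_le_iff[OF that(1)] by (cases i) (auto simp: grad_plus_def)
    ultimately show ?thesis
      using hamiltonian_le_iff[OF H[OF that(1)]] by blast
  qed
  have flux0: "?F 0 \<alpha> i \<le> a" if "\<alpha> \<in> {1..N}" for \<alpha> i
  proof -
    have "m_inf N \<Delta>t U 0 \<le> ereal (?W \<alpha> 0 i)"
      unfolding m_inf_def using that by (intro INF_lower2[of "(\<alpha>, i)"]) auto
    then show ?thesis
      by (simp add: m a_def W_flux[OF that])
  qed
  have deriv_le: "\<bar>deriv (H \<alpha>) p\<bar> \<le> \<Delta>x / \<Delta>t" if "\<alpha> \<in> {1..N}" "H \<alpha> p \<le> a" for \<alpha> p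
  proof -
    have "p_lower N H \<Delta>t U \<alpha> \<le> ereal p" "ereal p \<le> p_upper N H \<Delta>t U \<alpha>"
      using sublevel_between_inverses[OF H that(2)] that(1)
      by (simp_all add: p_lower_def p_upper_def neg_m)
    then have "ereal \<bar>deriv (H \<alpha>) p\<bar> \<le> ereal (\<Delta>x / \<Delta>t)"
      using assms(8) that(1) unfolding CFL_def SUP_le_iff by fastforce
    then show ?thesis by simp
  qed
  have pos: "0 < \<Delta>x / \<Delta>t"
    using \<Delta>x \<Delta>t by simp
  \<comment> \<open>The required point of the sublevel set is a gradient of the initial data, by
    \<open>sublevel\<close> and \<open>flux0\<close>.\<close>
  have "\<forall>\<alpha>\<in>{1..N}. \<exists>g. mono_lipschitz (\<Delta>x / \<Delta>t) g \<and>
      (\<forall>x. H_plus (H \<alpha>) x \<le> a \<or> g x \<le> a \<longrightarrow> g x = H_plus (H \<alpha>) x)"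
    using H_plus_extension[OF H pos sublevel[OF _ flux0]] deriv_le by blast
  then obtain P where P: "\<And>\<alpha>. \<alpha> \<in> {1..N} \<Longrightarrow> mono_lipschitz (\<Delta>x / \<Delta>t) (P \<alpha>)"
    and P_eq: "\<And>\<alpha> x. \<alpha> \<in> {1..N} \<Longrightarrow> H_plus (H \<alpha>) x \<le> a \<or> P \<alpha> x \<le> a \<Longrightarrow> P \<alpha> x = H_plus (H \<alpha>) x"
    by metis
  have "\<forall>\<alpha>\<in>{1..N}. \<exists>g. mono_lipschitz (\<Delta>x / \<Delta>t) (\<lambda>x. g (- x)) \<and>
      (\<forall>x. H_minus (H \<alpha>) x \<le> a \<or> g x \<le> a \<longrightarrow> g x = H_minus (H \<alpha>) x)"
    using H_minus_extension[OF H pos sublevel[OF _ flux0]] deriv_le by blast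
  then obtain Q where Q: "\<And>\<alpha>. \<alpha> \<in> {1..N} \<Longrightarrow> mono_lipschitz (\<Delta>x / \<Delta>t) (\<lambda>x. Q \<alpha> (- x))"
    and Q_eq: "\<And>\<alpha> x. \<alpha> \<in> {1..N} \<Longrightarrow> H_minus (H \<alpha>) x \<le> a \<or> Q \<alpha> x \<le> a \<Longrightarrow> Q \<alpha> x = H_minus (H \<alpha>) x"
    by metis
  let ?G = "\<lambda>n. junction_flux N \<Delta>x P Q (\<lambda>\<beta>. U \<beta> n)"
  have flux_eq: "?G n \<alpha> i = ?F n \<alpha> i" if "\<alpha> \<in> {1..N}" "?F n \<alpha> i \<le> a \<or> ?G n \<alpha> i \<le> a" for \<alpha> n i
    using that(2)
  proof
    assume "?F n \<alpha> i \<le> a"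
    then show ?thesis
      by (rule junction_flux_eq_below[OF that(1)]) (use P_eq Q_eq in auto)
  next
    assume "?G n \<alpha> i \<le> a"
    then show ?thesis
      by (rule junction_flux_eq_below[OF that(1), symmetric]) (metis P_eq Q_eq)+
  qed
  note comparison = junction_flux_comparison[OF \<Delta>x \<Delta>t _ P Q]
  have flux_le: "?F n \<alpha> i \<le> a" if "\<alpha> \<in> {1..N}" for n \<alpha> i
    using that
  proof (induction n arbitrary: \<alpha> i)
    case 0
    then show ?case by (rule flux0)
  next
    case (Suc n)
    have le: "U \<beta> n j + \<Delta>t * m \<le> U \<beta> (Suc n) j" if "\<beta> \<in> {1..N}" for \<beta> j
    proof -
      have "m \<le> ?W \<beta> n j"
        using Suc.IH[OF that, of j] by (simp add: W_flux[OF that] a_def)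
      then show ?thesis
        using \<Delta>t by (simp add: step)
    qed
    \<comment> \<open>Time slice \<open>n\<close> shifted by \<open>\<Delta>t * m\<close> is
      compared with slice \<open>Suc n\<close>. By induction slice \<open>n\<close> evolves by
      \<open>?G\<close>, so the values of \<open>U\<close> cancel and \<open>?G (Suc n)\<close> is
      at most \<open>a\<close>. Only then does \<open>flux_eq\<close>, read from \<open>?G\<close>
      to \<open>?F\<close>, bound the original flux.\<close>
    have "U \<alpha> n i + \<Delta>t * m - \<Delta>t * ?G n \<alpha> i \<le> U \<alpha> (Suc n) i - \<Delta>t * ?G (Suc n) \<alpha> i"
      by (rule comparison[OF Suc.prems]) (use le junction[OF Suc.prems] in auto)
    moreover have "U \<alpha> (Suc n) i = U \<alpha> n i - \<Delta>t * ?G n \<alpha> i"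
      using flux_eq[OF Suc.prems, of n i] Suc.IH[OF Suc.prems, of i]
      by (simp add: step W_flux[OF Suc.prems])
    ultimately have "\<Delta>t * ?G (Suc n) \<alpha> i \<le> \<Delta>t * a"
      by (simp add: a_def)
    then have "?G (Suc n) \<alpha> i \<le> a"
      using \<Delta>t by simp
    then show ?case
      using flux_eq[OF Suc.prems] by metis
  qed
  have step_G: "U \<alpha> (Suc n) i = U \<alpha> n i - \<Delta>t * ?G n \<alpha> i" if "\<alpha> \<in> {1..N}" for \<alpha> n i
    using flux_eq[OF that, of n i] flux_le[OF that, of n i] by (simp add: step W_flux[OF that])
  \<comment> \<open>With \<open>step_G\<close> valid at all times, the same comparison works for an
    arbitrary constant \<open>c\<close> in place of \<open>m\<close>: applying one step to both
    sides of \<open>le\<close> reproduces it one time level later.\<close>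
  have lower: "c \<le> ?W \<alpha> (Suc n) i"
    if "\<alpha> \<in> {1..N}" and c: "\<And>\<beta> j. \<beta> \<in> {1..N} \<Longrightarrow> c \<le> ?W \<beta> n j" for c n \<alpha> i
  proof -
    have le: "U \<beta> n j + \<Delta>t * c \<le> U \<beta> (Suc n) j" if "\<beta> \<in> {1..N}" for \<beta> j
      using c[OF that, of j] \<Delta>t by (simp add: step)
    have "U \<alpha> n i + \<Delta>t * c - \<Delta>t * ?G n \<alpha> i \<le> U \<alpha> (Suc n) i - \<Delta>t * ?G (Suc n) \<alpha> i"
      by (rule comparison[OF that(1)]) (use le junction[OF that(1)] in auto)
    then have "\<Delta>t * c \<le> \<Delta>t * ?W \<alpha> (Suc n) i"
      using step_G[OF that(1), of n i] step_G[OF that(1), of "Suc n" i] step[of \<alpha> "Suc n" i] by linarith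
    then show ?thesis using \<Delta>t by simp
  qed
  have upper: "?W \<alpha> (Suc n) i \<le> c"
    if "\<alpha> \<in> {1..N}" and c: "\<And>\<beta> j. \<beta> \<in> {1..N} \<Longrightarrow> ?W \<beta> n j \<le> c" for c n \<alpha> i
  proof -
    \<comment> \<open>For the upper bound the two time slices exchange roles and the shift changes
      sign.\<close>
    have le: "U \<beta> (Suc n) j + - (\<Delta>t * c) \<le> U \<beta> n j" if "\<beta> \<in> {1..N}" for \<beta> j
      using c[OF that, of j] \<Delta>t by (simp add: step)
    have "U \<alpha> (Suc n) i + - (\<Delta>t * c) - \<Delta>t * ?G (Suc n) \<alpha> i \<le> U \<alpha> n i - \<Delta>t * ?G n \<alpha> i"
      by (rule comparison[OF that(1)]) (use le junction[OF that(1)] in auto)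
    then have "\<Delta>t * ?W \<alpha> (Suc n) i \<le> \<Delta>t * c"
      using step_G[OF that(1), of n i] step_G[OF that(1), of "Suc n" i] step[of \<alpha> "Suc n" i] by linarith
    then show ?thesis using \<Delta>t by simp
  qed
  have one: "(1, 0) \<in> {1..N} \<times> (UNIV :: nat set)"
    using \<open>N \<ge> 1\<close> by simp
  have m_le: "m_inf N \<Delta>t U n \<le> ereal (?W \<alpha> n i)" if "\<alpha> \<in> {1..N}" for \<alpha> n i
    unfolding m_inf_def using that by (intro INF_lower2[of "(\<alpha>, i)"]) auto
  have le_M: "ereal (?W \<alpha> n i) \<le> M_sup N \<Delta>t U n" if "\<alpha> \<in> {1..N}" for \<alpha> n i
    unfolding M_sup_def using that by (intro SUP_upper2[of "(\<alpha>, i)"]) auto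
  \<comment> \<open>\<open>lower\<close> handles a real infimum; the value -infinity is trivial, and
    +infinity is excluded because the index set contains (1, 0). \<open>M_step\<close> is
    dual.\<close>
  have m_step: "m_inf N \<Delta>t U n \<le> m_inf N \<Delta>t U (Suc n)" for n
  proof (cases "m_inf N \<Delta>t U n")
    case (real c)
    then have "c \<le> ?W \<beta> n j" if "\<beta> \<in> {1..N}" for \<beta> j
      using m_le[OF that, of n j] by simp
    then show ?thesis
      using lower unfolding real m_inf_def[of _ _ _ "Suc n"] by (auto intro!: INF_greatest)
  next
    case PInf
    then show ?thesis using m_le[of 1 n 0] one by simp
  qed simp
  have M_step: "M_sup N \<Delta>t U (Suc n) \<le> M_sup N \<Delta>t U n" for n
  proof (cases "M_sup N \<Delta>t U n")
    case (real c)
    then have "?W \<beta> n j \<le> c" if "\<beta> \<in> {1..N}" for \<beta> j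
      using le_M[OF that, of n j] by simp
    then show ?thesis
      using upper unfolding real M_sup_def[of _ _ _ "Suc n"] by (auto intro!: SUP_least)
  next
    case MInf
    then show ?thesis using le_M[of 1 n 0] one by simp
  qed simp
  have mM: "m_inf N \<Delta>t U n \<le> M_sup N \<Delta>t U n" for n
    using m_le[of 1 n 0] le_M[of 1 n 0] one by (auto intro: order_trans)
  have m0: "m_inf N \<Delta>t U 0 \<le> m_inf N \<Delta>t U n" for n
    using lift_Suc_mono_le[of "m_inf N \<Delta>t U", OF m_step] by simp
  have M0: "M_sup N \<Delta>t U n \<le> M_sup N \<Delta>t U 0" for n
    using lift_Suc_antimono_le[of "M_sup N \<Delta>t U", OF M_step] by simp
  have "p_lower N H \<Delta>t U \<alpha> \<le> ereal (grad_plus \<Delta>x U \<alpha> n i)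
      \<and> ereal (grad_plus \<Delta>x U \<alpha> n i) \<le> p_upper N H \<Delta>t U \<alpha>" if "\<alpha> \<in> {1..N}" for \<alpha> n i
    using sublevel_between_inverses[OF H[OF that] sublevel[OF that flux_le[OF that]]]
    by (simp add: p_lower_def p_upper_def neg_m)
  then show ?thesis
    using m0 M0 m_step M_step mM by simp
qed

end
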